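(* If $G$ is a finite simple undirected $(P_6,\text{house})$-free graph that has an efficient dominating set, then its square $G^2$ is odd-antihole-free.
   Context: All graphs are finite, undirected and simple. A vertex dominates itself and its neighbors. A set $D\subseteq V$ is an efficient dominating set of $G=(V,E)$ if every vertex of $G$ is dominated by exactly one vertex of $D$. The square $G^2=(V,E^2)$ has $uv\in E^2$ iff $d_G(u,v)\in\{1,2\}$. $P_k$ is the chordless path on $k$ vertices; the house is the complement of $P_5$. $(P_6,\text{house})$-free means having no induced subgraph isomorphic to $P_6$ or to the house. Odd-antihole-free means having no induced subgraph isomorphic to the complement $\overline{C_{2k+1}}$ of a chordless cycle on $2k+1$ vertices, $k\ge 2$. *)

theory Defs
  imports "Graph_Theory.Graph_Theory"
begin

text \<open>
  A finite simple undirected graph is a \<^locale>\<open>pair_graph\<close>: a finite, loop-free, symmetric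
  digraph whose arcs are pairs of vertices, an edge \<open>uv\<close> being the two arcs \<open>(u, v)\<close> and \<open>(v, u)\<close>.
\<close>

definition path_graph :: "nat \<Rightarrow> nat pair_pre_digraph" where
  "path_graph k =
    \<lparr> pverts = {..<k},
      parcs = {(i, j). i < k \<and> j < k \<and> (j = Suc i \<or> i = Suc j)} \<rparr>"

text \<open>A cycle only for \<open>n \<ge> 3\<close>: \<open>n = 2\<close> gives a single edge and \<open>n = 1\<close> a loop.\<close>

definition cycle_graph :: "nat \<Rightarrow> nat pair_pre_digraph" where
  "cycle_graph n =
    \<lparr> pverts = {..<n},
      parcs = {(i, j). i < n \<and> j < n \<and> (j = Suc i mod n \<or> i = Suc j mod n)} \<rparr>"

definition complement_graph :: "'a pair_pre_digraph \<Rightarrow> 'a pair_pre_digraph" where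
  "complement_graph G =
    \<lparr> pverts = pverts G,
      parcs = {(u, v). u \<in> pverts G \<and> v \<in> pverts G \<and> u \<noteq> v \<and> (u, v) \<notin> parcs G} \<rparr>"

definition house_graph :: "nat pair_pre_digraph" where
  "house_graph = complement_graph (path_graph 5)"

definition has_induced :: "'b pair_pre_digraph \<Rightarrow> 'a pair_pre_digraph \<Rightarrow> bool" where
  "has_induced F G \<longleftrightarrow>
    (\<exists>H :: 'a pair_pre_digraph.
      induced_subgraph (with_proj H) (with_proj G) \<and> digraph_iso (with_proj F) (with_proj H))"

definition P6_house_free :: "'a pair_pre_digraph \<Rightarrow> bool" where
  "P6_house_free G \<longleftrightarrow> \<not> has_induced (path_graph 6) G \<and> \<not> has_induced house_graph G"

definition odd_antihole_free :: "'a pair_pre_digraph \<Rightarrow> bool" where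
  "odd_antihole_free G \<longleftrightarrow>
    (\<forall>k \<ge> 2. \<not> has_induced (complement_graph (cycle_graph (2 * k + 1))) G)"

text \<open>Distance: least number of arcs of a walk, \<open>\<infinity>\<close> between different components.\<close>

definition graph_dist :: "'a pair_pre_digraph \<Rightarrow> 'a \<Rightarrow> 'a \<Rightarrow> ereal" where
  "graph_dist G u v = wf_digraph.\<mu> (with_proj G) (\<lambda>_. 1) u v"

definition square_graph :: "'a pair_pre_digraph \<Rightarrow> 'a pair_pre_digraph" where
  "square_graph G =
    \<lparr> pverts = pverts G,
      parcs = {(u, v). u \<in> pverts G \<and> v \<in> pverts G \<and> graph_dist G u v \<in> {1, 2}} \<rparr>"

definition vertex_dominates :: "'a pair_pre_digraph \<Rightarrow> 'a \<Rightarrow> 'a \<Rightarrow> bool" where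
  "vertex_dominates G d v \<longleftrightarrow> v = d \<or> (d, v) \<in> parcs G"

definition efficient_dominating_set :: "'a pair_pre_digraph \<Rightarrow> 'a set \<Rightarrow> bool" where
  "efficient_dominating_set G D \<longleftrightarrow>
    D \<subseteq> pverts G \<and> (\<forall>v \<in> pverts G. \<exists>!d. d \<in> D \<and> vertex_dominates G d v)"

end

theory Submission
  imports Defs
begin

text \<open>
  Call two vertices close if they are equal or adjacent in the square, and let \<open>d v\<close> be the unique
  dominator of \<open>v\<close>. Consecutive vertices of an antihole of the square are not close, so they have
  different dominators; as the antihole is odd, some three consecutive vertices have three different
  dominators. If \<open>q, a, b, c, p\<close> are consecutive and \<open>a, b, c\<close> have three different dominators, then
  \<open>d p = d a\<close>. Hence from some point on the dominators repeat with period three around the antihole.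
  This is absurd for five vertices, and already six consecutive vertices of a longer antihole with
  this pattern force an induced \<open>P\<^sub>6\<close> or house.
\<close>

section \<open>Induced copies as vertex embeddings\<close>

text \<open>Arcs are pairs, so an isomorphism onto an induced subgraph is determined by its vertex
  map. Induced copies thus become injections that preserve and reflect adjacency.\<close>

lemma has_induced_iff:
  assumes "pair_wf_digraph F" "pair_wf_digraph G"
  shows "has_induced F G \<longleftrightarrow>
    (\<exists>f. inj_on f (pverts F) \<and> f ` pverts F \<subseteq> pverts G \<and>
      (\<forall>u\<in>pverts F. \<forall>v\<in>pverts F. (u, v) \<in> parcs F \<longleftrightarrow> (f u, f v) \<in> parcs G))"
    (is "_ \<longleftrightarrow> (\<exists>f. ?emb f)")
proof
  interpret F: pair_wf_digraph F by fact
  assume "has_induced F G"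
  then obtain H where ind: "induced_subgraph (with_proj H) (with_proj G)"
    and "digraph_iso (with_proj F) (with_proj H)"
    unfolding has_induced_def by blast
  then obtain h where h: "pre_digraph.digraph_isomorphism (with_proj F) h"
    and H: "with_proj H = app_iso h (with_proj F)"
    unfolding digraph_iso_def by blast
  \<comment> \<open>Both sides use the projections as tail and head; this equality forces the arc
    map to act componentwise.\<close>
  from H have V: "pverts H = iso_verts h ` pverts F" and A: "parcs H = iso_arcs h ` parcs F"
    and proj: "iso_tail h = fst" "iso_head h = snd"
    by (simp_all add: with_proj_def app_iso_def)
  from ind have VG: "pverts H \<subseteq> pverts G"
    and AG: "\<And>u v. (u, v) \<in> parcs H \<longleftrightarrow> (u, v) \<in> parcs G \<and> u \<in> pverts H \<and> v \<in> pverts H"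
    by (auto simp: induced_subgraph_def subgraph_def)
  from h have inj: "inj_on (iso_verts h) (pverts F)"
    and arc: "\<And>u v. (u, v) \<in> parcs F \<Longrightarrow> iso_arcs h (u, v) = (iso_verts h u, iso_verts h v)"
    using proj by (fastforce simp: pre_digraph.digraph_isomorphism_def intro: prod_eqI)+
  have "(u, v) \<in> parcs F \<longleftrightarrow> (iso_verts h u, iso_verts h v) \<in> parcs G"
    if uv: "u \<in> pverts F" "v \<in> pverts F" for u v
  proof
    assume "(u, v) \<in> parcs F"
    then show "(iso_verts h u, iso_verts h v) \<in> parcs G"
      using A AG arc by (metis imageI)
  next
    assume "(iso_verts h u, iso_verts h v) \<in> parcs G"
    then have "(iso_verts h u, iso_verts h v) \<in> parcs H"
      using AG V uv by blast
    then obtain u' v' where e: "(u', v') \<in> parcs F" "iso_arcs h (u', v') = (iso_verts h u, iso_verts h v)"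
      unfolding A by auto
    moreover have "u' \<in> pverts F" "v' \<in> pverts F"
      using e(1) F.in_arcsD1 F.in_arcsD2 by blast+
    ultimately show "(u, v) \<in> parcs F"
      using arc[OF e(1)] inj uv by (auto dest: inj_onD)
  qed
  then show "\<exists>f. ?emb f" using inj V VG by blast
next
  interpret F: pair_wf_digraph F by fact
  interpret G: pair_wf_digraph G by fact
  assume "\<exists>f. ?emb f"
  then obtain f where inj: "inj_on f (pverts F)" and VG: "f ` pverts F \<subseteq> pverts G"
    and arc: "\<And>u v. u \<in> pverts F \<Longrightarrow> v \<in> pverts F \<Longrightarrow> (u, v) \<in> parcs F \<longleftrightarrow> (f u, f v) \<in> parcs G"
    by blast
  let ?H = "\<lparr>pverts = f ` pverts F, parcs = map_prod f f ` parcs F\<rparr>"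
  let ?h = "\<lparr>iso_verts = f, iso_arcs = map_prod f f, iso_head = snd, iso_tail = fst\<rparr>"
  have A: "map_prod f f ` parcs F = {e \<in> parcs G. fst e \<in> f ` pverts F \<and> snd e \<in> f ` pverts F}"
  proof (intro equalityI subsetI)
    fix e
    assume "e \<in> map_prod f f ` parcs F"
    then obtain u v where "(u, v) \<in> parcs F" "e = (f u, f v)" by auto
    then show "e \<in> {e \<in> parcs G. fst e \<in> f ` pverts F \<and> snd e \<in> f ` pverts F}"
      using F.in_arcsD1[of u v] F.in_arcsD2[of u v] arc[of u v] by simp
  next
    fix e
    assume "e \<in> {e \<in> parcs G. fst e \<in> f ` pverts F \<and> snd e \<in> f ` pverts F}"
    then obtain u v where "u \<in> pverts F" "v \<in> pverts F" "e = (f u, f v)" "e \<in> parcs G"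
      by (cases e) auto
    then show "e \<in> map_prod f f ` parcs F"
      using arc[of u v] by (auto intro: rev_image_eqI)
  qed
  interpret H: pair_wf_digraph ?H
    by unfold_locales (auto dest: F.in_arcsD1 F.in_arcsD2)
  have "parcs F \<subseteq> pverts F \<times> pverts F"
    by (auto dest: F.in_arcsD1 F.in_arcsD2)
  then have "inj_on (map_prod f f) (parcs F)"
    by (rule inj_on_subset[OF map_prod_inj_on[OF inj inj]])
  then have "pre_digraph.digraph_isomorphism (with_proj F) ?h"
    using inj F.wf_digraph by (simp add: pre_digraph.digraph_isomorphism_def)
  moreover have "with_proj ?H = app_iso ?h (with_proj F)"
    by (simp add: with_proj_def app_iso_def)
  moreover have "induced_subgraph (with_proj ?H) (with_proj G)"
    using VG A H.wf_digraph G.wf_digraph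
    by (auto simp: induced_subgraph_def subgraph_def compatible_def)
  ultimately show "has_induced F G"
    unfolding has_induced_def digraph_iso_def by blast
qed

section \<open>Adjacency in the square\<close>

text \<open>Letting the midpoint \<open>m\<close> coincide with an end merges walks of one and of
  two arcs, so the infimum over walks becomes a local condition.\<close>

lemma (in pair_wf_digraph) square_graph_arc_iff:
  assumes "u \<in> pverts G" "v \<in> pverts G"
  shows "(u, v) \<in> parcs (square_graph G) \<longleftrightarrow>
    u \<noteq> v \<and> (\<exists>m. (u = m \<or> (u, m) \<in> parcs G) \<and> (m = v \<or> (m, v) \<in> parcs G))"
proof -
  have cost: "awalk_cost (\<lambda>_. 1) p = real (length p)" for p :: "('a \<times> 'a) list"
    by (induction p) auto
  have le: "graph_dist G u v \<le> ereal (length p)" if "awalk u p v" for p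
    using min_cost_le_walk_cost[OF that, of "\<lambda>_. 1"] by (simp add: graph_dist_def cost)
  have ge: "ereal n \<le> graph_dist G u v" if "\<And>p. awalk u p v \<Longrightarrow> n \<le> length p" for n :: nat
    unfolding graph_dist_def \<mu>_def cost using that by (auto intro!: INF_greatest)
  have walk0: "awalk u [] v \<longleftrightarrow> u = v"
    using assms by (auto simp: awalk_Nil_iff)
  have walk1: "(\<exists>e. awalk u [e] v) \<longleftrightarrow> (u, v) \<in> parcs G"
    using assms by (force simp: awalk_simps)
  have walk2: "(\<exists>e e'. awalk u [e, e'] v) \<longleftrightarrow> (\<exists>m. (u, m) \<in> parcs G \<and> (m, v) \<in> parcs G)"
    using assms by (force simp: awalk_simps)
  have "graph_dist G u v \<in> {1, 2} \<longleftrightarrow>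
    u \<noteq> v \<and> ((\<exists>e. awalk u [e] v) \<or> (\<exists>e e'. awalk u [e, e'] v))" (is "_ \<longleftrightarrow> ?short")
  proof
    assume *: "graph_dist G u v \<in> {1, 2}"
    then have "u \<noteq> v" using le[of "[]"] walk0 by auto
    \<comment> \<open>A distance of 1 or 2 is not bounded below by 3, hence some walk has fewer than
      three arcs.\<close>
    moreover have "\<not> ereal (3::nat) \<le> graph_dist G u v" using * by auto
    then obtain p where "awalk u p v" "length p < 3" using ge[of 3] by force
    then have "u = v \<or> (\<exists>e. awalk u [e] v) \<or> (\<exists>e e'. awalk u [e, e'] v)"
      using walk0 by (cases p; cases "tl p") auto
    ultimately show ?short by blast
  next
    assume short: ?short
    then have ge1: "1 \<le> length p" if "awalk u p v" for p
      using that walk0 by (cases p) auto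
    show "graph_dist G u v \<in> {1, 2}"
    proof (cases "\<exists>e. awalk u [e] v")
      case True
      then obtain e where "awalk u [e] v" by blast
      from le[OF this] ge[of 1, OF ge1] have "graph_dist G u v = 1"
        by (simp add: one_ereal_def)
      then show ?thesis by simp
    next
      case False
      with short obtain e e' where "awalk u [e, e'] v" by blast
      note le[OF this]
      moreover have "2 \<le> length p" if "awalk u p v" for p
        using ge1[OF that] that False by (cases p; cases "tl p") auto
      then have "ereal (2::nat) \<le> graph_dist G u v" by (rule ge)
      ultimately have "graph_dist G u v = 2" by simp
      then show ?thesis by simp
    qed
  qed
  then show ?thesis
    using assms walk1 walk2 by (auto simp: square_graph_def)
qed

section \<open>Dominators and excluded patterns for closed adjacency\<close>

text \<open>
  \<open>N\<close> is closed adjacency, hence reflexive. Neither \<open>P\<^sub>6\<close> nor the house has two vertices with the same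
  closed neighbourhood, so the excluded patterns need no distinctness hypotheses; this lets dominators
  and midpoints coincide with the vertices they belong to.
\<close>

locale efficiently_dominated =
  fixes N :: "'a \<Rightarrow> 'a \<Rightarrow> bool" and d :: "'a \<Rightarrow> 'a"
  assumes N_refl: "N u u"
    and N_sym: "N u v \<Longrightarrow> N v u"
    and N_dom: "N u (d v) \<longleftrightarrow> d u = d v"
    and no_P6: "\<lbrakk>N v\<^sub>1 v\<^sub>2; N v\<^sub>2 v\<^sub>3; N v\<^sub>3 v\<^sub>4; N v\<^sub>4 v\<^sub>5; N v\<^sub>5 v\<^sub>6;
      \<not> N v\<^sub>1 v\<^sub>3; \<not> N v\<^sub>1 v\<^sub>4; \<not> N v\<^sub>1 v\<^sub>5; \<not> N v\<^sub>1 v\<^sub>6; \<not> N v\<^sub>2 v\<^sub>4;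
      \<not> N v\<^sub>2 v\<^sub>5; \<not> N v\<^sub>2 v\<^sub>6; \<not> N v\<^sub>3 v\<^sub>5; \<not> N v\<^sub>3 v\<^sub>6; \<not> N v\<^sub>4 v\<^sub>6\<rbrakk> \<Longrightarrow> False"
    and no_house: "\<lbrakk>N v\<^sub>1 v\<^sub>2; N v\<^sub>2 v\<^sub>3; N v\<^sub>3 v\<^sub>4; N v\<^sub>4 v\<^sub>1; N v\<^sub>5 v\<^sub>1; N v\<^sub>5 v\<^sub>2;
      \<not> N v\<^sub>1 v\<^sub>3; \<not> N v\<^sub>2 v\<^sub>4; \<not> N v\<^sub>5 v\<^sub>3; \<not> N v\<^sub>5 v\<^sub>4\<rbrakk> \<Longrightarrow> False"
begin

text \<open>Since \<open>N\<close> is reflexive, \<open>m\<close> may be an end: this is adjacency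
  in the square together with equality.\<close>

definition close :: "'a \<Rightarrow> 'a \<Rightarrow> bool" where
  "close u v \<longleftrightarrow> (\<exists>m. N u m \<and> N m v)"

text \<open>The common dominator is a midpoint.\<close>

lemma close_if_dom_eq: "d u = d v \<Longrightarrow> close u v"
  unfolding close_def using N_dom N_sym by metis

lemma dom_dom: "d (d v) = d v"
  using N_dom N_refl by blast

text \<open>If \<open>u\<close> and \<open>v\<close> both have a neighbour in the class of a third dominator, a \<open>P\<^sub>6\<close> starts at \<open>d u\<close> and
  ends at \<open>d v\<close> (or, through the third dominator, at \<open>v\<close>).\<close>

lemma common_neighbour_class:
  assumes "\<not> close u v" "N u m" "N v n" "d m = d n" "d m \<noteq> d u" "d m \<noteq> d v"
  shows False
proof -
  have "d u \<noteq> d v" using assms(1) close_if_dom_eq by blast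
  \<comment> \<open>The first path serves when \<open>N m n\<close> holds, the second when it
    fails.\<close>
  then show False
    using assms N_sym N_dom N_refl no_P6[of "d u" u m n v "d v"] no_P6[of "d u" u m "d m" n v]
    unfolding close_def by metis
qed

text \<open>In the next two lemmas, a midpoint of a close pair such as \<open>a, c\<close> is named \<open>ac\<close>. Each proof is
  a propositional refutation from the listed instances; a SAT solver found these, by deleting
  instances from a refutation until none was redundant.\<close>

lemma fourth_dominator:
  assumes far: "\<not> close q a" "\<not> close a b" "\<not> close b c" "\<not> close c p"
    and near: "close q b" "close q c" "close a c" "close a p" "close b p"
    and "d a \<noteq> d c"
  shows "d p = d a"
proof (rule ccontr)
  assume "d p \<noteq> d a"
  \<comment> \<open>Far pairs have different dominators. So \<open>d p\<close> is either
    \<open>d b\<close> or a dominator of none of \<open>a, b, c\<close>.\<close>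
  moreover have "d q \<noteq> d a" "d a \<noteq> d b" "d b \<noteq> d c" "d c \<noteq> d p"
    using far close_if_dom_eq by blast+
  moreover from near obtain qb qc ac ap bp where
    "N q qb" "N qb b" "N q qc" "N qc c" "N a ac" "N ac c" "N a ap" "N ap p" "N b bp" "N bp p"
    unfolding close_def by blast
  \<comment> \<open>The folded facts match the hypothesis of \<open>common_neighbour_class\<close>;
    the unfolded ones exclude every vertex as a midpoint of a far pair.\<close>
  moreover note far far[unfolded close_def]
  ultimately show False
    using \<open>d a \<noteq> d c\<close> N_refl N_sym N_dom dom_dom
      no_P6[of "d a" a ac qb b "d b"] no_P6[of "d a" a ap bp b "d b"]
      no_P6[of "d a" a ap qc c "d c"] no_P6[of a ac c q qb b] no_P6[of a ap bp qb q c]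
      no_P6[of a ap p qb q c] no_P6[of a p "d p" qc c "d c"] no_P6[of a p "d q" q c "d c"]
      no_P6[of b "d b" ap ac c "d c"] no_P6[of "d b" b qb qc c "d c"] no_P6[of b bp ap a c "d c"]
      no_P6[of b bp ap ac c "d c"] no_P6[of b bp p ap ac c] no_P6[of b qb "d a" a ac c]
      no_P6[of b qb qc c a "d a"] no_P6[of b qb qc ac a "d a"] no_P6[of b "d q" qc ac a "d a"]
      no_P6[of "d c" c ac a p "d p"] no_P6[of "d c" c ac ap p "d p"]
      no_P6[of "d c" c ac bp p "d p"] no_P6[of c "d c" ap p q "d q"]
      no_P6[of c "d c" qb p a "d a"] no_P6[of c ac a ap p "d p"] no_P6[of c qc "d q" ap a "d a"]
      no_P6[of c q bp ap a "d a"] no_P6[of c q qb b "d b" p] no_P6[of bp p ap a c "d c"]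
      no_P6[of qb q qc c a "d a"] no_P6[of qb q qc ac a "d a"] no_P6[of qb q "d q" c a "d a"]
      no_P6[of qc c a ap p "d p"] no_P6[of p ap a ac c "d c"] no_P6[of p "d p" ac c qc "d a"]
      no_P6[of p q qc ac a "d a"] no_P6[of q c ac a ap "d p"] no_P6[of q qb b bp ap a]
      no_P6[of q qb b p ap a] no_P6[of q qc "d a" a ac "d c"] no_P6[of q qc c ac a "d a"]
      no_P6[of q "d q" c ac a "d a"] no_P6[of "d q" q c ac a "d a"]
      no_P6[of q "d q" ac a p "d p"] no_P6[of q "d q" ac ap p "d p"]
      no_P6[of "d q" q qb ac a "d a"] no_P6[of "d q" q qc ac a "d a"]
      no_P6[of "d q" q qc ap p "d p"] no_P6[of q "d q" p ap a "d a"]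
      no_house[of c "d q" q qc ac] no_house[of ac ap "d c" c a] no_house[of ac ap p "d q" a]
      no_house[of ac qc "d a" a c] no_house[of ac qc q "d q" c] no_house[of ac "d q" q qb c]
      no_house[of ap ac bp p a] no_house[of bp ap a "d a" p] no_house[of qb ac c q ap]
      no_house[of qc ac qb q c] no_house[of q c ac qb "d q"] no_house[of q p ap qc "d q"]
      common_neighbour_class[of a b c bp] common_neighbour_class[of a b ap qb]
      common_neighbour_class[of a b ap p] common_neighbour_class[of b c qb a]
    by (smt (z3))
qed

lemma period_three_contradiction:
  assumes dom: "d a = d p" "d b = d q" "d c = d r" "d a \<noteq> d c"
    and far: "\<not> close a b" "\<not> close b c" "\<not> close c p" "\<not> close p q" "\<not> close q r"
    and near: "close a q" "close a r" "close b p" "close b r" "close c q"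
  shows False
proof -
  have "d a \<noteq> d b" "d b \<noteq> d c"
    using far close_if_dom_eq by blast+
  moreover from near obtain aq ar bp br cq where
    "N a aq" "N aq q" "N a ar" "N ar r" "N b bp" "N bp p" "N b br" "N br r" "N c cq" "N cq q"
    unfolding close_def by blast
  moreover note dom far far[unfolded close_def]
  ultimately show False
    using N_refl N_sym N_dom dom_dom
      no_P6[of a aq q b br r] no_P6[of a ar r br b q] no_P6[of b "d b" cq c "d c" r]
      no_P6[of b "d b" q cq c "d c"] no_P6[of b "d b" q cq "d c" r] no_P6[of b br r c cq q]
      no_P6[of b q aq a ar r] no_P6[of b q aq a r "d c"] no_P6[of c "d c" br b "d b" q]
      no_P6[of c "d c" r b "d b" q] no_P6[of bp b "d b" q c "d c"]
      no_P6[of "d br" br b q aq "d aq"] no_P6[of q b br r a "d a"]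
      no_house[of br aq q b ar] no_house[of q b br aq "d b"] no_house[of r c cq br "d c"]
      common_neighbour_class[of c p q bp] common_neighbour_class[of p q bp c]
    by (smt (z3))
qed

section \<open>Dominators around an odd antihole\<close>

text \<open>The hypothesis on \<open>f\<close> expresses the complement of an \<open>n\<close>-cycle
  through \<open>close\<close>, so the argument runs on cyclic index differences alone.\<close>

lemma no_odd_antihole:
  fixes f :: "nat \<Rightarrow> 'a" and k :: nat
  assumes "k \<ge> 2" and n: "n = 2 * k + 1"
    and close_f: "\<And>i j. i < n \<Longrightarrow> j < n \<Longrightarrow> i \<noteq> j \<Longrightarrow>
      close (f i) (f j) \<longleftrightarrow> j \<noteq> Suc i mod n \<and> i \<noteq> Suc j mod n"
  shows False
proof -
  have n5: "n \<ge> 5" using assms by simp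
  \<comment> \<open>The periodic extension of \<open>f\<close> lets indices grow without
    wrapping.\<close>
  define w where "w i = f (i mod n)" for i
  have w_n: "w (i + n) = w i" for i by (simp add: w_def)
  have bound: "i mod n < n" for i using n5 by simp
  have shift: "(i + e) mod n = (if i mod n + e < n then i mod n + e else i mod n + e - n)"
    if "e < n" for i e
  proof -
    have "i mod n + e - n < n" using that bound[of i] by linarith
    moreover have "(i + e) mod n = (i mod n + e) mod n" by (simp add: mod_add_left_eq)
    ultimately show ?thesis by (simp add: le_mod_geq)
  qed
  have Suc_mod: "Suc j mod n = (if Suc j = n then 0 else Suc j)" if "j < n" for j
    using that by simp
  \<comment> \<open>The difference \<open>n - 1\<close> is a single step in the other
    direction.\<close>
  have close_w: "close (w i) (w (i + e)) \<longleftrightarrow> e \<noteq> 1 \<and> e \<noteq> n - 1" if "0 < e" "e < n" for i e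
  proof -
    define a b where "a = i mod n" and "b = (i + e) mod n"
    have ab: "a < n" "b < n" "b = (if a + e < n then a + e else a + e - n)"
      using shift[of e i] that bound unfolding a_def b_def by blast+
    have "close (w i) (w (i + e)) \<longleftrightarrow> b \<noteq> Suc a mod n \<and> a \<noteq> Suc b mod n"
      using close_f[of a b] ab that by (auto simp: w_def a_def b_def split: if_splits)
    also have "\<dots> \<longleftrightarrow> e \<noteq> 1 \<and> e \<noteq> n - 1"
      unfolding Suc_mod[OF ab(1)] Suc_mod[OF ab(2)] using ab that n5 by (simp split: if_splits; arith)
    finally show ?thesis .
  qed
  have neq: "d (w i) \<noteq> d (w (Suc i))" for i
    using close_w[of 1 i] n5 close_if_dom_eq by auto
  have "\<exists>i. d (w i) \<noteq> d (w (i + 2))"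
  proof (rule ccontr)
    assume "\<not> ?thesis"
    then have eq: "d (w (i + 2)) = d (w i)" for i by metis
    \<comment> \<open>Oddness enters here: \<open>w (2 * k)\<close> gets the dominator of
      \<open>w 0\<close>, but its successor is \<open>w n\<close>, which is \<open>w 0\<close>
      again.\<close>
    have "d (w (2 * i)) = d (w 0)" for i by (induction i) (use eq in auto)
    then show False using neq[of "2 * k"] w_n[of 0] n by (metis Suc_eq_plus1 add_0)
  qed
  then obtain i where start: "d (w i) \<noteq> d (w (i + 2))" ..
  have period_Suc: "d (w (Suc j + 3)) = d (w (Suc j))" if "d (w (Suc j)) \<noteq> d (w (Suc j + 2))" for j
  proof -
    have sh: "Suc j = j + 1" "Suc j + 2 = j + 3" "Suc j + 3 = j + 4" by auto
    show ?thesis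
      unfolding sh
    \<comment> \<open>The five vertices are \<open>w j\<close>, ..., \<open>w (j + 4)\<close>. The
      pairs concerned have differences at most 3, below \<open>n - 1\<close> even for
      \<open>n = 5\<close>.\<close>
    proof (rule fourth_dominator[where b = "w (j + 2)" and q = "w j" and c = "w (j + 3)"])
      show "d (w (j + 1)) \<noteq> d (w (j + 3))" using that by (simp add: numeral_3_eq_3)
    qed (use n5 close_w[of 1 j] close_w[of 2 j] close_w[of 3 j]
        close_w[of 1 "j + 1"] close_w[of 2 "j + 1"] close_w[of 3 "j + 1"]
        close_w[of 1 "j + 2"] close_w[of 2 "j + 2"] close_w[of 1 "j + 3"]
        in \<open>auto simp: numeral_eq_Suc\<close>)
  qed
  have period: "d (w (j + 3)) = d (w j)" if "d (w j) \<noteq> d (w (j + 2))" for j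
  proof -
    \<comment> \<open>\<open>period_Suc\<close> needs a predecessor in the role of \<open>q\<close>;
      replacing \<open>j\<close> by \<open>j + n\<close> provides one also for
      \<open>j = 0\<close>.\<close>
    have "Suc (j + n - 1) = j + n" using n5 by simp
    note period_Suc[of "j + n - 1", unfolded this]
    then show ?thesis using that w_n[of j] w_n[of "j + 2"] w_n[of "j + 3"] by (simp add: ac_simps)
  qed
  define v where "v j = w (i + j)" for j
  have v1: "d (v j) \<noteq> d (v (Suc j))" for j
    using neq[of "i + j"] by (simp add: v_def)
  have v2: "d (v j) \<noteq> d (v (j + 2))" for j
  proof (induction j)
    case 0
    then show ?case using start by (simp add: v_def)
  next
    case (Suc j)
    \<comment> \<open>The dominator of \<open>v (j + 3)\<close> is that of \<open>v j\<close>, which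
      differs from that of the next vertex \<open>v (Suc j)\<close>.\<close>
    then have "d (v (j + 3)) = d (v j)" using period[of "i + j"] by (simp add: v_def add.assoc)
    then show ?case using v1[of j] by (simp add: numeral_eq_Suc)
  qed
  have v3: "d (v (j + 3)) = d (v j)" for j
    using period[of "i + j"] v2[of j] by (simp add: v_def add.assoc)
  have close_v: "close (v j) (v (j + e)) \<longleftrightarrow> e \<noteq> 1 \<and> e \<noteq> n - 1" if "0 < e" "e < n" for j e
    using close_w[OF that, of "i + j"] by (simp add: v_def add.assoc)
  show False
  proof (cases "n = 5")
    case True
    \<comment> \<open>Period three gives \<open>v 6\<close> the dominator of \<open>v 0\<close>,
      although \<open>v 6\<close> is \<open>v 1\<close>, the successor of
      \<open>v 0\<close>.\<close>
    then have "v 6 = v 1" using w_n[of "i + 1"] by (simp add: v_def add.commute)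
    then show False using v3[of 0] v3[of 3] v1[of 0] by simp
  next
    case False
    \<comment> \<open>Now differences up to 5 stay below \<open>n - 1\<close>, so no two of
      \<open>v 0\<close>, ..., \<open>v 5\<close> are consecutive across the wrap-around.\<close>
    then have "n \<ge> 7" using n assms(1) by presburger
    show False
    proof (rule period_three_contradiction)
      show "d (v 0) = d (v 3)" "d (v 1) = d (v 4)" "d (v 2) = d (v 5)"
        using v3[of 0] v3[of 1] v3[of 2] by simp_all
      show "d (v 0) \<noteq> d (v 2)"
        using v2[of 0] by (metis add_0)
    qed (use \<open>n \<ge> 7\<close> close_v[of 1 0] close_v[of 1 1] close_v[of 1 2] close_v[of 1 3] close_v[of 1 4]
        close_v[of 4 0] close_v[of 2 1] close_v[of 4 1] close_v[of 2 2] close_v[of 5 0]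
        in \<open>simp_all add: numeral_eq_Suc\<close>)
  qed
qed
end

section \<open>From graphs to closed adjacency\<close>

context pair_graph
begin

definition closed_adj :: "'a \<Rightarrow> 'a \<Rightarrow> bool" where
  "closed_adj u v \<longleftrightarrow> u = v \<or> (u, v) \<in> parcs G"

lemma closed_adj_sym: "closed_adj u v \<Longrightarrow> closed_adj v u"
  unfolding closed_adj_def using pair_sym_arcs by (auto simp: symmetric_def elim: symE)

lemma P6_free_closed_adj:
  assumes "\<not> has_induced (path_graph 6) G"
    and "closed_adj v\<^sub>1 v\<^sub>2" "closed_adj v\<^sub>2 v\<^sub>3" "closed_adj v\<^sub>3 v\<^sub>4" "closed_adj v\<^sub>4 v\<^sub>5" "closed_adj v\<^sub>5 v\<^sub>6"
    and "\<not> closed_adj v\<^sub>1 v\<^sub>3" "\<not> closed_adj v\<^sub>1 v\<^sub>4" "\<not> closed_adj v\<^sub>1 v\<^sub>5" "\<not> closed_adj v\<^sub>1 v\<^sub>6"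
      "\<not> closed_adj v\<^sub>2 v\<^sub>4" "\<not> closed_adj v\<^sub>2 v\<^sub>5" "\<not> closed_adj v\<^sub>2 v\<^sub>6"
      "\<not> closed_adj v\<^sub>3 v\<^sub>5" "\<not> closed_adj v\<^sub>3 v\<^sub>6" "\<not> closed_adj v\<^sub>4 v\<^sub>6"
  shows False
proof -
  let ?vs = "[v\<^sub>1, v\<^sub>2, v\<^sub>3, v\<^sub>4, v\<^sub>5, v\<^sub>6]"
  have F: "pair_wf_digraph (path_graph 6)"
    by unfold_locales (auto simp: path_graph_def)
  have six: "{..<6::nat} = {0, 1, 2, 3, 4, 5}" by auto
  \<comment> \<open>Any two of the six are told apart by closed adjacency to some vertex of the
    list.\<close>
  have dist: "distinct ?vs"
    using assms(2-) by (auto simp: closed_adj_def)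
  have arcs: "(v\<^sub>1, v\<^sub>2) \<in> parcs G" "(v\<^sub>2, v\<^sub>3) \<in> parcs G" "(v\<^sub>3, v\<^sub>4) \<in> parcs G"
    "(v\<^sub>4, v\<^sub>5) \<in> parcs G" "(v\<^sub>5, v\<^sub>6) \<in> parcs G"
    using assms(2-6) dist by (auto simp: closed_adj_def)
  note sym = closed_adj_sym[unfolded closed_adj_def]
  have loop: "(v, v) \<notin> parcs G" for v using pair_no_loops by fastforce
  have "has_induced (path_graph 6) G"
    unfolding has_induced_iff[OF F pair_wf_digraph_axioms]
  proof (intro exI conjI)
    show "inj_on ((!) ?vs) (pverts (path_graph 6))"
      using dist by (intro inj_on_nth) (auto simp: path_graph_def)
    show "(!) ?vs ` pverts (path_graph 6) \<subseteq> pverts G"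
      using arcs by (auto simp: path_graph_def six dest: in_arcsD1 in_arcsD2)
    show "\<forall>u\<in>pverts (path_graph 6). \<forall>v\<in>pverts (path_graph 6).
      (u, v) \<in> parcs (path_graph 6) \<longleftrightarrow> (?vs ! u, ?vs ! v) \<in> parcs G"
      using arcs assms(7-) sym loop dist by (simp add: path_graph_def six closed_adj_def) metis
  qed
  with assms(1) show False ..
qed

lemma house_free_closed_adj:
  assumes "\<not> has_induced house_graph G"
    and "closed_adj v\<^sub>1 v\<^sub>2" "closed_adj v\<^sub>2 v\<^sub>3" "closed_adj v\<^sub>3 v\<^sub>4" "closed_adj v\<^sub>4 v\<^sub>1" "closed_adj v\<^sub>5 v\<^sub>1" "closed_adj v\<^sub>5 v\<^sub>2"
    and "\<not> closed_adj v\<^sub>1 v\<^sub>3" "\<not> closed_adj v\<^sub>2 v\<^sub>4" "\<not> closed_adj v\<^sub>5 v\<^sub>3" "\<not> closed_adj v\<^sub>5 v\<^sub>4"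
  shows False
proof -
  \<comment> \<open>The order follows the four non-adjacent pairs, which form the path whose
    complement is the house.\<close>
  let ?vs = "[v\<^sub>1, v\<^sub>3, v\<^sub>5, v\<^sub>4, v\<^sub>2]"
  have F: "pair_wf_digraph house_graph"
    by unfold_locales (auto simp: house_graph_def complement_graph_def)
  have five: "{..<5::nat} = {0, 1, 2, 3, 4}" by auto
  have dist: "distinct ?vs"
    using assms(2-) closed_adj_sym by (auto simp: closed_adj_def)
  have arcs: "(v\<^sub>1, v\<^sub>2) \<in> parcs G" "(v\<^sub>2, v\<^sub>3) \<in> parcs G" "(v\<^sub>3, v\<^sub>4) \<in> parcs G"
    "(v\<^sub>4, v\<^sub>1) \<in> parcs G" "(v\<^sub>5, v\<^sub>1) \<in> parcs G" "(v\<^sub>5, v\<^sub>2) \<in> parcs G"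
    using assms(2-7) dist by (auto simp: closed_adj_def)
  note sym = closed_adj_sym[unfolded closed_adj_def]
  have loop: "(v, v) \<notin> parcs G" for v using pair_no_loops by fastforce
  have "has_induced house_graph G"
    unfolding has_induced_iff[OF F pair_wf_digraph_axioms]
  proof (intro exI conjI)
    show "inj_on ((!) ?vs) (pverts house_graph)"
      using dist by (intro inj_on_nth) (auto simp: house_graph_def complement_graph_def path_graph_def)
    show "(!) ?vs ` pverts house_graph \<subseteq> pverts G"
      using arcs by (auto simp: house_graph_def complement_graph_def path_graph_def five dest: in_arcsD1 in_arcsD2)
    show "\<forall>u\<in>pverts house_graph. \<forall>v\<in>pverts house_graph.
      (u, v) \<in> parcs house_graph \<longleftrightarrow> (?vs ! u, ?vs ! v) \<in> parcs G"
      using arcs assms(8-) sym loop dist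
      by (simp add: house_graph_def complement_graph_def path_graph_def five closed_adj_def) metis
  qed
  with assms(1) show False ..
qed

text \<open>If \<open>d v\<close> dominates \<open>u\<close>, uniqueness of the dominator makes it
  equal to \<open>d u\<close>; this is \<open>N_dom\<close>.\<close>

lemma efficiently_dominated_closed_adj:
  assumes "P6_house_free G" and D: "efficient_dominating_set G D"
  shows "\<exists>d. efficiently_dominated closed_adj d"
proof
  have no_P6: "\<not> has_induced (path_graph 6) G" and no_house: "\<not> has_induced house_graph G"
    using assms(1) by (simp_all add: P6_house_free_def)
  \<comment> \<open>The locale speaks of the whole type. Off the vertex set closed adjacency is
    equality, so there \<open>d\<close> must be the identity.\<close>
  define d where "d v = (if v \<in> pverts G then THE x. x \<in> D \<and> vertex_dominates G x v else v)" for v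
  have DV: "D \<subseteq> pverts G" and ex1: "\<And>v. v \<in> pverts G \<Longrightarrow> \<exists>!x. x \<in> D \<and> vertex_dominates G x v"
    using D by (auto simp: efficient_dominating_set_def)
  have d_in: "d v \<in> D" "vertex_dominates G (d v) v" if "v \<in> pverts G" for v
    using theI'[OF ex1[OF that]] that by (auto simp: d_def)
  have d_eq: "d v = x" if "v \<in> pverts G" "x \<in> D" "vertex_dominates G x v" for v x
    using ex1[OF that(1)] d_in[OF that(1)] that(2,3) by blast
  have dominates_iff: "vertex_dominates G x v \<longleftrightarrow> closed_adj v x" for x v
    using closed_adj_sym[of v x] closed_adj_sym[of x v] by (auto simp: vertex_dominates_def closed_adj_def)
  show "efficiently_dominated closed_adj d"
  proof
    show "closed_adj u (d v) \<longleftrightarrow> d u = d v" for u v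
    proof (cases "u \<in> pverts G \<and> v \<in> pverts G")
      case True
      then show ?thesis using d_in[of u] d_in[of v] d_eq[of u "d v"] dominates_iff by metis
    next
      case False
      have "d w \<in> pverts G \<longleftrightarrow> w \<in> pverts G" "w \<notin> pverts G \<Longrightarrow> d w = w" for w
        using d_in(1)[of w] DV by (auto simp: d_def)
      moreover have "closed_adj u w \<longleftrightarrow> u = w" if "u \<notin> pverts G \<or> w \<notin> pverts G" for w
        using that by (auto simp: closed_adj_def dest: in_arcsD1 in_arcsD2)
      ultimately show ?thesis using False by metis
    qed
  next
    show "closed_adj u u" for u by (simp add: closed_adj_def)
    show "closed_adj u v \<Longrightarrow> closed_adj v u" for u v by (rule closed_adj_sym)
  qed ((rule P6_free_closed_adj[OF no_P6]; assumption), (rule house_free_closed_adj[OF no_house]; assumption))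
qed
end

section \<open>From an antihole of the square to a cyclic closeness pattern\<close>

theorem theorem4:
  fixes G :: "'a pair_pre_digraph"
  assumes "pair_graph G"
    and "P6_house_free G"
    and "\<exists>D. efficient_dominating_set G D"
  shows "odd_antihole_free (square_graph G)"
  unfolding odd_antihole_free_def
proof (intro allI impI notI)
  interpret pair_graph G by fact
  fix k :: nat
  let ?n = "2 * k + 1"
  let ?F = "complement_graph (cycle_graph ?n)"
  assume "k \<ge> 2" and ind: "has_induced ?F (square_graph G)"
  have F: "pair_wf_digraph ?F" and S: "pair_wf_digraph (square_graph G)"
    by unfold_locales (auto simp: complement_graph_def square_graph_def)
  have "pverts ?F = {..<?n}" "pverts (square_graph G) = pverts G"
    by (simp_all add: complement_graph_def cycle_graph_def square_graph_def)
  with ind obtain f where inj: "inj_on f {..<?n}" and V: "f ` {..<?n} \<subseteq> pverts G"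
    and arc: "\<And>i j. i < ?n \<Longrightarrow> j < ?n \<Longrightarrow>
      (i, j) \<in> parcs ?F \<longleftrightarrow> (f i, f j) \<in> parcs (square_graph G)"
    unfolding has_induced_iff[OF F S] by (metis lessThan_iff)
  from assms obtain d where "efficiently_dominated closed_adj d"
    using efficiently_dominated_closed_adj by blast
  then interpret efficiently_dominated closed_adj d .
  show False
  proof (rule no_odd_antihole[OF \<open>k \<ge> 2\<close> refl])
    fix i j assume ij: "i < ?n" "j < ?n" "i \<noteq> j"
    then have "f i \<in> pverts G" "f j \<in> pverts G" "f i \<noteq> f j"
      using V inj by (auto dest: inj_onD)
    \<comment> \<open>As \<open>close\<close> also holds for equal vertices, injectivity of
      \<open>f\<close> is what permits passing to adjacency in the square.\<close>
    then have "close (f i) (f j) \<longleftrightarrow> (f i, f j) \<in> parcs (square_graph G)"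
      by (simp add: square_graph_arc_iff close_def closed_adj_def)
    also have "\<dots> \<longleftrightarrow> j \<noteq> Suc i mod ?n \<and> i \<noteq> Suc j mod ?n"
      using arc[OF ij(1,2)] ij by (simp add: complement_graph_def cycle_graph_def)
    finally show "close (f i) (f j) \<longleftrightarrow> j \<noteq> Suc i mod ?n \<and> i \<noteq> Suc j mod ?n" .
  qed
qed
end
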